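(* Let $n_1,n_2\ge 0$ be integers, let $\mathcal X=\{x_j\}_{j=1}^m\subset\mathbb C$ be a set of $m\ge n_1+n_2+2$ distinct points, and let $f:\mathcal X\to\mathbb C$ with $f\notin\mathscr R_{(n_1,n_2)}$ (i.e. $f$ does not agree on $\mathcal X$ with any element of $\mathscr R_{(n_1,n_2)}$). Let $\hat\xi=\hat p/\hat q\in\mathscr R_{(n_1,n_2)}$ be irreducible and a local minimax approximant to $f$ on $\mathcal X$, with defect $\upsilon(\hat p,\hat q)$; put $n=n_1+n_2-\upsilon(\hat p,\hat q)$ and write $\mathcal E(\hat\xi)=\{z_j\}_{j=1}^d\subseteq\mathcal X$ with $d=|\mathcal E(\hat\xi)|$. Let $\{\pi_j\}_{j=1}^{n+1}$ be a basis of $\mathbb P_n$ and let $\Pi_n\in\mathbb C^{d\times(n+1)}$ have entries $[\Pi_n]_{i,j}=\pi_j(z_i)$. Then: (1) $\displaystyle \max_{x\in\mathcal E(\hat\xi)}\mathrm{Re}\left(\overline{(f(x)-\hat\xi(x))\hat q(x)}\,\frac{g(x)}{\hat q(x)}\right)\ge 0$ for all $g\in\mathbb P_n$; (2) there exist $r$ extreme points $y_1,\dots,y_r\in\mathcal E(\hat\xi)$ with $n+2\le r\le 2n+3$, and positive numbers $\omega_1,\dots,\omega_r$ with $\sum_{j=1}^r\omega_j=1$, such that $\sum_{j=1}^r\omega_j\,\overline{(f(y_j)-\hat\xi(y_j))\hat q(y_j)}\,g(y_j)/\hat q(y_j)=0$ for all $g\in\mathbb P_n$; (3) for every $(s,t)\in\mathbb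 S$, $$\max\left\{\boldsymbol\omega^{T}\boldsymbol\rho(z):\ \boldsymbol\omega\in\mathbb R^d,\ \boldsymbol\omega\ge 0,\ \boldsymbol\omega^{T}\mathbf e=1,\ E^{T}\boldsymbol\omega=\mathbf 0\right\}\ge 0,$$ where $\mathbf e=[1,\dots,1]^T\in\mathbb R^d$, $\boldsymbol\rho(z)=[\rho(z_1),\dots,\rho(z_d)]^T\in\mathbb R^d$, and $E=[\Pi^{\mathtt r},-\Pi^{\mathtt i}]\in\mathbb R^{d\times 2(n+1)}$ with $\Pi^{\mathtt r},\Pi^{\mathtt i}$ the real and imaginary parts of $\Pi=D\,\Pi_n\in\mathbb C^{d\times(n+1)}$, $D=\mathrm{diag}(\tau_1,\dots,\tau_d)$, $\tau_j=2\,\overline{\hat e(z_j)\hat q(z_j)}/\hat q(z_j)$.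
   Context: $\mathbb P_k$ is the space of complex polynomials of degree at most $k$. $\mathscr R_{(n_1,n_2)}=\{p/q: p\in\mathbb P_{n_1},\ 0\not\equiv q\in\mathbb P_{n_2}\}$; a rational function is identified with its irreducible representation, and its error on $\mathcal X$ is infinite if it has a pole in $\mathcal X$. For $\xi\in\mathscr R_{(n_1,n_2)}$, $\|f-\xi\|_{\infty,\mathcal X}=\max_{x\in\mathcal X}|f(x)-\xi(x)|$. $\hat\xi$ is a local minimax approximant to $f$ on $\mathcal X$ if $\|f-\hat\xi\|_{\infty,\mathcal X}<\infty$ and there is $\varepsilon>0$ with $\|f-\xi\|_{\infty,\mathcal X}\ge\|f-\hat\xi\|_{\infty,\mathcal X}$ for all $\xi\in\mathscr R_{(n_1,n_2)}$ such that $\|\xi-\hat\xi\|_{\infty,\mathcal X}<\varepsilon$. In particular $\hat q$ has no zeros in $\mathcal X$. The defect of an irreducible $p/q\in\mathscr R_{(n_1,n_2)}$ is $\upsilon(p,q)=\min(n_1-\deg p,\ n_2-\deg q)$, with $\deg 0=-\infty$. Put $\hat e(x)=f(x)-\hat\xi(x)$. The set of extreme points is $\mathcal E(\hat\xi)=\{x\in\mathcal X: |\hat e(x)|=\|\hat e\|_{\infty,\mathcal X}\}$. For $(s,t)\in\mathbb P_{n_1}\times\mathbb P_{n_2}$ let $g=t\hat p-s\hat q\in\mathbb P_n$ and $$\kappa(x)=2\,\mathrm{Re}\left(\overline{\hat e(x)\hat q(x)}\,g(x)/\hat q(x)\right),\qquad \rho(x)=|f(x)t(x)-s(x)|^2-|f(x)t(x)-\hat\xi(x)t(x)|^2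 .$$ $\mathbb S=\{(s,t)\in\mathbb P_{n_1}\times\mathbb P_{n_2}:\ \kappa(x)=0\ \text{for all } x\in\mathcal E(\hat\xi)\}$. *)

theory Defs
  imports
    "HOL-Library.Extended_Real"
    "HOL-Computational_Algebra.Computational_Algebra"
    "HOL-Computational_Algebra.Field_as_Ring"
    "Jordan_Normal_Form.Matrix"
begin

definition poly_space :: "nat \<Rightarrow> complex poly set" where
  "poly_space k = {p. degree p \<le> k}"

text \<open>The family \<open>\<pi> 0, \<dots>, \<pi> k\<close> is a basis of the complex vector space \<open>poly_space k\<close>.
  The vector space structure on polynomials is given by the scalar multiplication \<^const>\<open>Polynomial.smult\<close>.\<close>

definition poly_space_basis :: "nat \<Rightarrow> (nat \<Rightarrow> complex poly) \<Rightarrow> bool" where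
  "poly_space_basis k \<pi> \<longleftrightarrow>
     inj_on \<pi> {..k} \<and>
     \<not> Modules.module.dependent Polynomial.smult (\<pi> ` {..k}) \<and>
     Modules.module.span Polynomial.smult (\<pi> ` {..k}) = poly_space k"

text \<open>Rational functions are elements of the fraction field of \<^typ>\<open>complex poly\<close>.
  Poles and values refer to an irreducible representation; \<^const>\<open>quot_of_fract\<close> picks
  the one with monic denominator. A value at a pole is a junk value.\<close>

definition ratfuns :: "nat \<Rightarrow> nat \<Rightarrow> complex poly fract set" where
  "ratfuns n1 n2 = {Fraction_Field.Fract p q | p q. p \<in> poly_space n1 \<and> q \<in> poly_space n2 \<and> q \<noteq> 0}"

definition irreducible_repr :: "complex poly fract \<Rightarrow> complex poly \<Rightarrow> complex poly \<Rightarrow> bool" where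
  "irreducible_repr \<xi> p q \<longleftrightarrow> q \<noteq> 0 \<and> coprime p q \<and> \<xi> = Fraction_Field.Fract p q"

definition rat_pole :: "complex poly fract \<Rightarrow> complex \<Rightarrow> bool" where
  "rat_pole \<xi> x \<longleftrightarrow> poly (snd (quot_of_fract \<xi>)) x = 0"

definition rat_eval :: "complex poly fract \<Rightarrow> complex \<Rightarrow> complex" where
  "rat_eval \<xi> x = poly (fst (quot_of_fract \<xi>)) x / poly (snd (quot_of_fract \<xi>)) x"

definition sup_norm :: "complex set \<Rightarrow> (complex \<Rightarrow> complex) \<Rightarrow> real" where
  "sup_norm X h = (MAX x\<in>X. cmod (h x))"

definition rat_error :: "complex set \<Rightarrow> (complex \<Rightarrow> complex) \<Rightarrow> complex poly fract \<Rightarrow> ereal" where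
  "rat_error X f \<xi> =
     (if \<exists>x\<in>X. rat_pole \<xi> x then \<infinity> else ereal (sup_norm X (\<lambda>x. f x - rat_eval \<xi> x)))"

definition agrees_on :: "complex set \<Rightarrow> (complex \<Rightarrow> complex) \<Rightarrow> complex poly fract \<Rightarrow> bool" where
  "agrees_on X f \<xi> \<longleftrightarrow> (\<forall>x\<in>X. \<not> rat_pole \<xi> x \<and> rat_eval \<xi> x = f x)"

text \<open>The distance of \<open>\<eta>\<close> to the approximant \<open>\<xi>\<close>, which has no pole in \<open>X\<close>, is expressed
  as the error of \<open>\<eta>\<close> in approximating the function \<open>rat_eval \<xi>\<close>; it is infinite if \<open>\<eta>\<close> has
  a pole in \<open>X\<close>.\<close>

definition local_minimax ::
    "nat \<Rightarrow> nat \<Rightarrow> complex set \<Rightarrow> (complex \<Rightarrow> complex) \<Rightarrow> complex poly fract \<Rightarrow> bool" where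
  "local_minimax n1 n2 X f \<xi> \<longleftrightarrow>
     \<xi> \<in> ratfuns n1 n2 \<and> rat_error X f \<xi> < \<infinity> \<and>
     (\<exists>\<epsilon>>0. \<forall>\<eta>\<in>ratfuns n1 n2.
        rat_error X (rat_eval \<xi>) \<eta> < ereal \<epsilon> \<longrightarrow> rat_error X f \<xi> \<le> rat_error X f \<eta>)"

text \<open>The case \<open>p = 0\<close> reflects the convention that the zero polynomial has degree minus infinity
  (whereas \<^term>\<open>degree 0 = 0\<close> here). There is no truncation for \<open>p \<in> poly_space n1\<close> and
  \<open>q \<in> poly_space n2\<close>.\<close>

definition defect :: "nat \<Rightarrow> nat \<Rightarrow> complex poly \<Rightarrow> complex poly \<Rightarrow> nat" where
  "defect n1 n2 p q =
     (if p = 0 then n2 - degree q else min (n1 - degree p) (n2 - degree q))"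

definition err :: "(complex \<Rightarrow> complex) \<Rightarrow> complex poly fract \<Rightarrow> complex \<Rightarrow> complex" where
  "err f \<xi> x = f x - rat_eval \<xi> x"

definition extreme_points ::
    "complex set \<Rightarrow> (complex \<Rightarrow> complex) \<Rightarrow> complex poly fract \<Rightarrow> complex set" where
  "extreme_points X f \<xi> = {x \<in> X. cmod (err f \<xi> x) = sup_norm X (err f \<xi>)}"

definition kappa ::
    "(complex \<Rightarrow> complex) \<Rightarrow> complex poly fract \<Rightarrow> complex poly \<Rightarrow> complex poly \<Rightarrow>
     complex poly \<Rightarrow> complex poly \<Rightarrow> complex \<Rightarrow> real" where
  "kappa f \<xi> p q s t x =
     2 * Re (cnj (err f \<xi> x * poly q x) * (poly (t * p - s * q) x / poly q x))"

definition rho ::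
    "(complex \<Rightarrow> complex) \<Rightarrow> complex poly fract \<Rightarrow> complex poly \<Rightarrow> complex poly \<Rightarrow> complex \<Rightarrow> real" where
  "rho f \<xi> s t x =
     (cmod (f x * poly t x - poly s x))\<^sup>2 - (cmod (f x * poly t x - rat_eval \<xi> x * poly t x))\<^sup>2"

definition critical_directions ::
    "nat \<Rightarrow> nat \<Rightarrow> complex set \<Rightarrow> (complex \<Rightarrow> complex) \<Rightarrow> complex poly fract \<Rightarrow>
     complex poly \<Rightarrow> complex poly \<Rightarrow> (complex poly \<times> complex poly) set" where
  "critical_directions n1 n2 X f \<xi> p q =
     {(s, t). s \<in> poly_space n1 \<and> t \<in> poly_space n2 \<and>
        (\<forall>x\<in>extreme_points X f \<xi>. kappa f \<xi> p q s t x = 0)}"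

text \<open>In the matrices below, points \<open>z i\<close> and basis polynomials \<open>\<pi> j\<close> are indexed from 0:
  \<open>i < d\<close> and \<open>j \<le> n\<close>.\<close>

definition basis_mat :: "nat \<Rightarrow> nat \<Rightarrow> (nat \<Rightarrow> complex) \<Rightarrow> (nat \<Rightarrow> complex poly) \<Rightarrow> complex mat" where
  "basis_mat d n z \<pi> = mat d (n + 1) (\<lambda>(i, j). poly (\<pi> j) (z i))"

definition tau ::
    "(complex \<Rightarrow> complex) \<Rightarrow> complex poly fract \<Rightarrow> complex poly \<Rightarrow> complex \<Rightarrow> complex" where
  "tau f \<xi> q x = 2 * cnj (err f \<xi> x * poly q x) / poly q x"

definition scaled_basis_mat ::
    "(complex \<Rightarrow> complex) \<Rightarrow> complex poly fract \<Rightarrow> complex poly \<Rightarrow> nat \<Rightarrow> nat \<Rightarrow>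
     (nat \<Rightarrow> complex) \<Rightarrow> (nat \<Rightarrow> complex poly) \<Rightarrow> complex mat" where
  "scaled_basis_mat f \<xi> q d n z \<pi> = mat_diag d (\<lambda>j. tau f \<xi> q (z j)) * basis_mat d n z \<pi>"

text \<open>The real matrix with the two column blocks \<open>Re A\<close> and \<open>- Im A\<close>
  (the two lower blocks have no rows).\<close>

definition Re_neg_Im_mat :: "complex mat \<Rightarrow> real mat" where
  "Re_neg_Im_mat A =
     four_block_mat (map_mat Re A) (- map_mat Im A) (0\<^sub>m 0 (dim_col A)) (0\<^sub>m 0 (dim_col A))"

definition feasible_weights :: "real mat \<Rightarrow> real vec set" where
  "feasible_weights E =
     {\<omega> \<in> carrier_vec (dim_row E).
        (\<forall>i<dim_row E. 0 \<le> \<omega> $ i) \<and>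
        \<omega> \<bullet> vec (dim_row E) (\<lambda>_. 1) = 1 \<and>
        transpose_mat E *\<^sub>v \<omega> = 0\<^sub>v (dim_col E)}"

definition objective_values :: "real mat \<Rightarrow> real vec \<Rightarrow> real set" where
  "objective_values E \<rho> = {\<omega> \<bullet> \<rho> | \<omega>. \<omega> \<in> feasible_weights E}"

definition rho_vec ::
    "(complex \<Rightarrow> complex) \<Rightarrow> complex poly fract \<Rightarrow> complex poly \<Rightarrow> complex poly \<Rightarrow>
     nat \<Rightarrow> (nat \<Rightarrow> complex) \<Rightarrow> real vec" where
  "rho_vec f \<xi> s t d z = vec d (\<lambda>i. rho f \<xi> s t (z i))"


lemma vector_space_smult: "Vector_Spaces.vector_space (Polynomial.smult :: complex \<Rightarrow> complex poly \<Rightarrow> _)"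
  by unfold_locales (simp_all add: smult_add_left smult_add_right)

lemma irreducible_repr_quot_of_fract:
  assumes "irreducible_repr \<xi> p q"
  obtains c where "c \<noteq> 0" and "p = Polynomial.smult c (fst (quot_of_fract \<xi>))"
    and "q = Polynomial.smult c (snd (quot_of_fract \<xi>))"
proof -
  have q: "q \<noteq> 0" and cop: "coprime p q" and \<xi>: "\<xi> = Fraction_Field.Fract p q"
    using assms by (auto simp: irreducible_repr_def)
  have qf: "quot_of_fract \<xi> = normalize_quot (p, q)"
    using q quot_of_fract_quot_to_fract[of "(p, q)"] by (simp add: \<xi> quot_to_fract_def)
  obtain e where e: "p = fst (normalize_quot (p, q)) * e" "q = snd (normalize_quot (p, q)) * e"
      "e dvd p" "e dvd q" "e \<noteq> 0"
    by (rule normalize_quotE[OF q])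
  have "is_unit e"
    using coprime_common_divisor[OF cop e(3,4)] .
  then obtain c where c: "e = [:c:]" "c \<noteq> 0"
    using \<open>e \<noteq> 0\<close> by (auto simp: is_unit_poly_iff)
  show thesis
  proof (rule that[OF c(2)])
    show "p = Polynomial.smult c (fst (quot_of_fract \<xi>))"
      unfolding qf by (rule trans[OF e(1)]) (simp add: c(1))
    show "q = Polynomial.smult c (snd (quot_of_fract \<xi>))"
      unfolding qf by (rule trans[OF e(2)]) (simp add: c(1))
  qed
qed

lemma irreducible_repr_rat_pole: "irreducible_repr \<xi> p q \<Longrightarrow> rat_pole \<xi> x \<longleftrightarrow> poly q x = 0"
  by (erule irreducible_repr_quot_of_fract) (simp add: rat_pole_def)

lemma irreducible_repr_rat_eval: "irreducible_repr \<xi> p q \<Longrightarrow> rat_eval \<xi> x = poly p x / poly q x"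
  by (erule irreducible_repr_quot_of_fract) (simp add: rat_eval_def)

end

theory Submission
  imports Defs
    "HOL-Analysis.Function_Topology"
    "HOL-Analysis.Convex_Euclidean_Space"
begin

text \<open>Linear programming duality turns the claims into a statement about competitors. If (3) failed
  for a pair \<open>(s, t)\<close>, there would be \<open>g = w p - u q\<close> in \<open>poly_space n\<close> such that
  \<open>rho + Re (tau g) < 0\<close> at all extreme points. Since \<open>kappa\<close> vanishes there, the curve
  \<open>(p + \<epsilon> s + \<epsilon>\<^sup>2 u) / (q + \<epsilon> t + \<epsilon>\<^sup>2 w)\<close> then beats the local
  minimax approximant for small \<open>\<epsilon> > 0\<close>. The choice \<open>s = t = 0\<close> yields (1) and, through a
  Caratheodory reduction of the dual weights, the upper bound on \<open>r\<close> in (2). The lower bound holds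
  because a polynomial of degree at most \<open>n\<close> can vanish at all but one of \<open>n + 1\<close> points.\<close>

section \<open>Weights annihilating a finite family of functions\<close>

text \<open>The feasible set of a linear program on the simplex over \<open>I\<close>. Fixing the
  value 0 outside \<open>I\<close> keeps it bounded in every coordinate, so that it is compact in
  the product topology on functions.\<close>

definition annihilating_weights ::
    "'a set \<Rightarrow> 'k set \<Rightarrow> ('k \<Rightarrow> 'a \<Rightarrow> real) \<Rightarrow> ('a \<Rightarrow> real) set" where
  "annihilating_weights I K h =
     {\<omega>. (\<forall>x\<in>I. 0 \<le> \<omega> x) \<and> (\<forall>x. x \<notin> I \<longrightarrow> \<omega> x = 0) \<and> (\<Sum>x\<in>I. \<omega> x) = 1 \<and>
         (\<forall>k\<in>K. (\<Sum>x\<in>I. \<omega> x * h k x) = 0)}"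

lemma continuous_on_weighted_sum:
  "continuous_on S (\<lambda>\<omega>::'a \<Rightarrow> real. \<Sum>x\<in>I. \<omega> x * r x)"
  by (intro continuous_intros continuous_on_subset[OF continuous_on_product_coordinates]) auto

text \<open>Normalisation and nonnegativity confine every coordinate to [0, 1], so the set is cut
  out by continuous equations from a product of compact intervals, which is compact by
  Tychonoff.\<close>

lemma compact_annihilating_weights:
  assumes "finite I"
  shows "compact (annihilating_weights I K h)"
proof -
  define B where "B = (\<Pi>\<^sub>E x\<in>UNIV. if x \<in> I then {0..1} else {0::real})"
  have "compactin (product_topology (\<lambda>_. euclidean) UNIV) B"
    by (simp add: B_def compactin_PiE)
  then have B: "compact B"
    by (simp add: euclidean_product_topology)
  have le1: "\<omega> x \<le> 1" if "\<omega> \<in> annihilating_weights I K h" "x \<in> I" for \<omega> x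
    using that member_le_sum[of x I \<omega>] assms by (auto simp: annihilating_weights_def)
  have "annihilating_weights I K h =
      B \<inter> ({\<omega>. (\<Sum>x\<in>I. \<omega> x * 1) = 1} \<inter> (\<Inter>k\<in>K. {\<omega>. (\<Sum>x\<in>I. \<omega> x * h k x) = 0}))" (is "_ = ?R")
  proof
    show "annihilating_weights I K h \<subseteq> ?R"
      using le1 by (auto simp: annihilating_weights_def B_def PiE_def Pi_def)
    show "?R \<subseteq> annihilating_weights I K h"
      by (auto simp: annihilating_weights_def B_def PiE_def Pi_def split: if_splits)
  qed
  moreover have "closed ({\<omega>::'a \<Rightarrow> real. (\<Sum>x\<in>I. \<omega> x * 1) = 1} \<inter> (\<Inter>k\<in>K. {\<omega>. (\<Sum>x\<in>I. \<omega> x * h k x) = 0}))"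
    by (intro closed_Int closed_INT ballI closed_Collect_eq continuous_on_weighted_sum continuous_on_const)
  ultimately show ?thesis
    using compact_Int_closed[OF B] by simp
qed

lemma annihilating_weights_convex:
  assumes "\<omega> \<in> annihilating_weights I K h" "\<omega>' \<in> annihilating_weights I K h"
    and "0 \<le> u" "0 \<le> v" "u + v = 1"
  shows "(\<lambda>x. u * \<omega> x + v * \<omega>' x) \<in> annihilating_weights I K h"
proof -
  have "(\<Sum>x\<in>I. (u * \<omega> x + v * \<omega>' x) * r x) = u * (\<Sum>x\<in>I. \<omega> x * r x) + v * (\<Sum>x\<in>I. \<omega>' x * r x)" for r
    by (simp add: sum.distrib distrib_right mult.assoc sum_distrib_left)
  from this this[of "\<lambda>_. 1"] show ?thesis
    using assms by (simp add: annihilating_weights_def)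
qed

text \<open>The planar core of the duality: \<open>c\<close> is the multiplier of a constraint
  \<open>x = 0\<close>. If \<open>C\<close> missed the closed half-line, a line with normal
  \<open>(a1, a2)\<close> would separate the two strictly, and \<open>a2\<close> cannot be negative.
  A positive \<open>a2\<close> refutes the multiplier \<open>a1 / a2\<close>; for
  \<open>a2 = 0\<close>, boundedness of \<open>C\<close> refutes a sufficiently large multiple of
  \<open>a1\<close>.\<close>

lemma compact_convex_meets_half_line:
  fixes C :: "(real \<times> real) set"
  assumes "compact C" "convex C"
    and half: "\<And>c. \<exists>(x, y)\<in>C. 0 \<le> y + c * x"
  shows "\<exists>y\<ge>0. (0, y) \<in> C"
proof (rule ccontr)
  assume no: "\<not> ?thesis"
  define L where "L = {0::real} \<times> {0::real..}"
  have "C \<noteq> {}"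
    using half by fastforce
  moreover have "convex L" "closed L"
    by (auto simp: L_def intro: convex_Times closed_Times)
  moreover have "C \<inter> L = {}"
    using no by (auto simp: L_def)
  ultimately obtain a \<gamma> where sep: "\<And>z. z \<in> C \<Longrightarrow> inner a z < \<gamma>" "\<And>z. z \<in> L \<Longrightarrow> \<gamma> < inner a z"
    using separating_hyperplane_compact_closed[OF \<open>convex C\<close> \<open>compact C\<close>] by metis
  obtain a1 a2 where a: "a = (a1, a2)"
    by fastforce
  have C: "a1 * x + a2 * y < \<gamma>" if "(x, y) \<in> C" for x y
    using sep(1)[OF that] by (simp add: a)
  have L: "\<gamma> < a2 * y" if "y \<ge> 0" for y
    using sep(2)[of "(0, y)"] that by (simp add: a L_def)
  have "\<gamma> < 0"
    using L[of 0] by simp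
  have "a2 \<ge> 0"
  proof (rule ccontr)
    assume "\<not> ?thesis"
    then show False
      using L[of "\<gamma> / a2"] \<open>\<gamma> < 0\<close> by (simp add: divide_nonpos_neg)
  qed
  show False
  proof (cases "a2 = 0")
    case False
    obtain x y where "(x, y) \<in> C" and "0 \<le> y + a1 / a2 * x"
      using half[of "a1 / a2"] by auto
    then have "0 \<le> a2 * (y + a1 / a2 * x)"
      using \<open>a2 \<ge> 0\<close> by simp
    also have "\<dots> = a1 * x + a2 * y"
      using False by (simp add: algebra_simps)
    finally show False
      using C[OF \<open>(x, y) \<in> C\<close>] \<open>\<gamma> < 0\<close> by simp
  next
    case True
    have "bounded C"
      using \<open>compact C\<close> by (rule compact_imp_bounded)
    then obtain b where "0 < b" and b: "\<And>z. z \<in> C \<Longrightarrow> norm z \<le> b"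
      by (auto simp: bounded_pos)
    \<comment> \<open>Here \<open>a1 * x < \<gamma> < 0\<close> and \<open>y \<le> b\<close> on
      \<open>C\<close>; the factor \<open>b / (- \<gamma>)\<close> is scaled to force
      \<open>c * x < - b\<close>.\<close>
    define c where "c = b / (- \<gamma>) * a1"
    obtain x y where xy: "(x, y) \<in> C" and ge: "0 \<le> y + c * x"
      using half[of c] by auto
    have "y \<le> b"
      using b[OF xy] norm_snd_le[of y x] by simp
    have "b / (- \<gamma>) * (a1 * x) < b / (- \<gamma>) * \<gamma>"
      using C[OF xy] True \<open>0 < b\<close> \<open>\<gamma> < 0\<close> by (intro mult_strict_left_mono) (auto intro: divide_pos_neg)
    then have "c * x < - b"
      using \<open>\<gamma> < 0\<close> by (simp add: c_def mult.assoc)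
    then show False
      using \<open>y \<le> b\<close> ge by simp
  qed
qed

text \<open>A Farkas-type alternative, by induction on the number of constraints. For each
  multiplier \<open>c\<close> of the new function, \<open>c * h l\<close> is absorbed into
  \<open>\<rho>\<close> and the induction hypothesis supplies weights for the old constraints. The
  pairs (new constraint, objective) of all such weights form a compact convex set in the plane that
  meets every half-plane \<open>0 \<le> y + c * x\<close>, hence also the half-line where the new
  constraint holds and the objective is nonnegative.\<close>

lemma annihilating_weights_alternative:
  fixes h :: "'k \<Rightarrow> 'a \<Rightarrow> real"
  assumes "finite I" "finite K"
    and "\<And>c. \<exists>x\<in>I. 0 \<le> \<rho> x + (\<Sum>k\<in>K. c k * h k x)"
  shows "\<exists>\<omega>\<in>annihilating_weights I K h. 0 \<le> (\<Sum>x\<in>I. \<omega> x * \<rho> x)"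
  using assms(2,3)
proof (induction K arbitrary: \<rho> rule: finite_induct)
  case empty
  then obtain x where "x \<in> I" "0 \<le> \<rho> x"
    by auto
  then show ?case
    \<comment> \<open>Without constraints, the unit mass at \<open>x\<close> suffices.\<close>
    using \<open>finite I\<close> by (intro bexI[of _ "\<lambda>y. if y = x then 1 else 0"])
      (auto simp: annihilating_weights_def if_distrib[where f = "\<lambda>a. a * _"] cong: if_cong)
next
  case (insert l K)
  define \<Phi> where "\<Phi> \<omega> = (\<Sum>x\<in>I. \<omega> x * h l x, \<Sum>x\<in>I. \<omega> x * \<rho> x)" for \<omega>
  define C where "C = \<Phi> ` annihilating_weights I K h"
  have "compact C"
    unfolding C_def \<Phi>_def
    by (intro compact_continuous_image continuous_on_Pair continuous_on_weighted_sum
        compact_annihilating_weights \<open>finite I\<close>)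
  moreover have "convex C"
  proof (rule convexI)
    fix a b and u v :: real
    assume "a \<in> C" "b \<in> C" and uv: "0 \<le> u" "0 \<le> v" "u + v = 1"
    then obtain \<omega> \<omega>' where w: "\<omega> \<in> annihilating_weights I K h" "\<omega>' \<in> annihilating_weights I K h"
      and ab: "a = \<Phi> \<omega>" "b = \<Phi> \<omega>'"
      by (auto simp: C_def)
    have "u *\<^sub>R a + v *\<^sub>R b = \<Phi> (\<lambda>x. u * \<omega> x + v * \<omega>' x)"
      by (simp add: ab \<Phi>_def sum_distrib_left sum.distrib distrib_right mult.assoc)
    then show "u *\<^sub>R a + v *\<^sub>R b \<in> C"
      using annihilating_weights_convex[OF w uv] by (simp add: C_def)
  qed
  moreover have "\<exists>(x, y)\<in>C. 0 \<le> y + c * x" for c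
  proof -
    have "\<exists>x\<in>I. 0 \<le> (\<rho> x + c * h l x) + (\<Sum>k\<in>K. b k * h k x)" for b
    proof -
      have "(\<Sum>k\<in>K. (b(l := c)) k * h k x) = (\<Sum>k\<in>K. b k * h k x)" for x
        using insert.hyps(2) by (intro sum.cong) auto
      then show ?thesis
        using insert.prems[of "b(l := c)"] insert.hyps by (simp add: add.assoc)
    qed
    then obtain \<omega> where "\<omega> \<in> annihilating_weights I K h" "0 \<le> (\<Sum>x\<in>I. \<omega> x * (\<rho> x + c * h l x))"
      using insert.IH[of "\<lambda>x. \<rho> x + c * h l x"] by auto
    moreover have "(\<Sum>x\<in>I. \<omega> x * (\<rho> x + c * h l x)) = snd (\<Phi> \<omega>) + c * fst (\<Phi> \<omega>)"
      by (simp add: \<Phi>_def sum.distrib distrib_left sum_distrib_left mult.left_commute)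
    ultimately show ?thesis
      by (auto simp: C_def case_prod_unfold)
  qed
  ultimately obtain y where "y \<ge> 0" "(0, y) \<in> C"
    using compact_convex_meets_half_line by blast
  then obtain \<omega> where "\<omega> \<in> annihilating_weights I K h" "(\<Sum>x\<in>I. \<omega> x * h l x) = 0"
      "0 \<le> (\<Sum>x\<in>I. \<omega> x * \<rho> x)"
    by (auto simp: C_def \<Phi>_def)
  then show ?case
    by (auto simp: annihilating_weights_def)
qed

section \<open>Caratheodory reduction of the support\<close>

text \<open>Gaussian elimination: a pivot \<open>h l y \<noteq> 0\<close> removes the unknown
  \<open>y\<close> from the remaining equations, the induction hypothesis solves the smaller system,
  and back substitution in equation \<open>l\<close> gives the value \<open>a\<close> at
  \<open>y\<close>.\<close>

lemma homogeneous_system_nontrivial: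
  fixes h :: "'k \<Rightarrow> 'a \<Rightarrow> real"
  assumes "finite K" "finite S" "card K < card S"
  shows "\<exists>c. (\<exists>x\<in>S. c x \<noteq> 0) \<and> (\<forall>k\<in>K. (\<Sum>x\<in>S. c x * h k x) = 0)"
  using assms
proof (induction K arbitrary: S h rule: finite_induct)
  case empty
  then show ?case
    by (intro exI[of _ "\<lambda>_. 1"]) (auto simp: card_gt_0_iff)
next
  case (insert l K)
  show ?case
  proof (cases "\<forall>x\<in>S. h l x = 0")
    case True
    then show ?thesis
      using insert.IH[of S h] insert.prems insert.hyps by auto
  next
    case False
    then obtain y where y: "y \<in> S" "h l y \<noteq> 0"
      by auto
    have "card K < card (S - {y})"
      using insert.prems insert.hyps y by simp
    then obtain c where c: "\<exists>x\<in>S - {y}. c x \<noteq> 0"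
      and eq: "\<And>k. k \<in> K \<Longrightarrow> (\<Sum>x\<in>S - {y}. c x * (h k x - h k y / h l y * h l x)) = 0"
      using insert.IH[of "S - {y}" "\<lambda>k x. h k x - h k y / h l y * h l x"] insert.prems by auto
    define a where "a = - (\<Sum>x\<in>S - {y}. c x * h l x) / h l y"
    have split: "(\<Sum>x\<in>S. (c(y := a)) x * h k x) = a * h k y + (\<Sum>x\<in>S - {y}. c x * h k x)" for k
    proof -
      have "(\<Sum>x\<in>S - {y}. (c(y := a)) x * h k x) = (\<Sum>x\<in>S - {y}. c x * h k x)"
        by (intro sum.cong) auto
      then show ?thesis
        using y(1) insert.prems(1) by (simp add: sum.remove[of S y])
    qed
    have "(\<Sum>x\<in>S. (c(y := a)) x * h k x) = 0" if "k \<in> K" for k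
    proof -
      have "(\<Sum>x\<in>S - {y}. c x * h k x) = h k y / h l y * (\<Sum>x\<in>S - {y}. c x * h l x)"
        using eq[OF that] by (simp add: sum_subtractf right_diff_distrib sum_distrib_left mult.left_commute)
      then show ?thesis
        by (simp only: split) (simp add: a_def)
    qed
    moreover have "(\<Sum>x\<in>S. (c(y := a)) x * h l x) = 0"
      using y(2) by (simp only: split) (simp add: a_def)
    moreover have "\<exists>x\<in>S. (c(y := a)) x \<noteq> 0"
      using c by auto
    ultimately show ?thesis
      by (metis insert_iff)
  qed
qed

text \<open>The constraints number \<open>card K + 1\<close>, counting the normalisation. A larger
  support carries a nonzero direction \<open>c\<close> preserving all of them, and moving along it
  until a weight vanishes shrinks the support, contrary to its minimal choice.\<close>

lemma annihilating_weights_small_support: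
  assumes "finite I" "finite K" "annihilating_weights I K h \<noteq> {}"
  shows "\<exists>\<omega>\<in>annihilating_weights I K h. card {x\<in>I. 0 < \<omega> x} \<le> card K + 1"
proof -
  define supp where "supp \<omega> = {x\<in>I. 0 < \<omega> x}" for \<omega> :: "'a \<Rightarrow> real"
  obtain \<omega> where w: "\<omega> \<in> annihilating_weights I K h"
    and least: "\<And>\<omega>'. \<omega>' \<in> annihilating_weights I K h \<Longrightarrow> card (supp \<omega>) \<le> card (supp \<omega>')"
    using ex_has_least_nat[of "\<lambda>\<omega>. \<omega> \<in> annihilating_weights I K h" _ "\<lambda>\<omega>. card (supp \<omega>)"] assms(3)
    by auto
  define S where "S = supp \<omega>"
  have S: "finite S" "S \<subseteq> I" "\<And>x. x \<in> S \<Longrightarrow> 0 < \<omega> x"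
    using assms(1) by (auto simp: S_def supp_def)
  have "card S \<le> card K + 1"
  proof (rule ccontr)
    assume "\<not> ?thesis"
    \<comment> \<open>\<open>None\<close> indexes the normalisation, \<open>Some k\<close> the
      annihilation of \<open>h k\<close>.\<close>
    then have "card (insert None (Some ` K)) < card S"
      using assms(2) by (simp add: card_image)
    then obtain c where nz: "\<exists>x\<in>S. c x \<noteq> 0"
      and c: "\<forall>k\<in>insert None (Some ` K). (\<Sum>x\<in>S. c x * (case k of None \<Rightarrow> 1 | Some k \<Rightarrow> h k x)) = 0"
      using homogeneous_system_nontrivial[of "insert None (Some ` K)" S
          "\<lambda>k x. case k of None \<Rightarrow> 1 | Some k \<Rightarrow> h k x"] assms(2) S(1) by auto
    have c1: "sum c S = 0" and ck: "\<And>k. k \<in> K \<Longrightarrow> (\<Sum>x\<in>S. c x * h k x) = 0"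
      using c by auto
    define P where "P = {x\<in>S. 0 < c x}"
    have "P \<noteq> {}"
    proof
      assume "P = {}"
      then have "\<And>x. x \<in> S \<Longrightarrow> 0 \<le> - c x"
        by (auto simp: P_def not_less)
      moreover have "(\<Sum>x\<in>S. - c x) = 0"
        using c1 by (simp add: sum_negf)
      ultimately show False
        using nz sum_nonneg_eq_0_iff[of S "\<lambda>x. - c x"] S(1) by auto
    qed
    moreover have "finite P"
      using S(1) by (simp add: P_def)
    ultimately obtain y where y: "y \<in> P" and ymin: "\<And>x. x \<in> P \<Longrightarrow> \<omega> y / c y \<le> \<omega> x / c x"
      using arg_min_if_finite(1)[of P "\<lambda>x. \<omega> x / c x"] arg_min_least[of P _ "\<lambda>x. \<omega> x / c x"] by blast
    \<comment> \<open>The largest step that keeps all weights nonnegative: the least ratio over the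
      indices with \<open>c x > 0\<close>, attained at \<open>y\<close>, whose weight becomes
      0.\<close>
    define t where "t = \<omega> y / c y"
    define \<omega>' where "\<omega>' x = \<omega> x - (if x \<in> S then t * c x else 0)" for x
    have "y \<in> S" "0 < c y"
      using y by (auto simp: P_def)
    then have "0 < t"
      using S(3) by (simp add: t_def)
    have nonneg: "0 \<le> \<omega>' x" if "x \<in> I" for x
    proof (cases "x \<in> P")
      case True
      then show ?thesis
        using ymin[OF True] by (simp add: \<omega>'_def P_def t_def field_simps)
    next
      case False
      then have "x \<in> S \<Longrightarrow> t * c x \<le> 0"
        using \<open>0 < t\<close> by (auto simp: P_def mult_nonneg_nonpos)
      then show ?thesis
        using w that by (force simp: \<omega>'_def annihilating_weights_def)
    qed
    have sums: "(\<Sum>x\<in>I. \<omega>' x * r x) = (\<Sum>x\<in>I. \<omega> x * r x) - t * (\<Sum>x\<in>S. c x * r x)" for r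
    proof -
      have "(\<Sum>x\<in>I. (if x \<in> S then t * c x else 0) * r x) = (\<Sum>x\<in>S. t * c x * r x)"
        using S(2) assms(1) by (intro sum.mono_neutral_cong_right) auto
      then show ?thesis
        by (simp add: \<omega>'_def left_diff_distrib sum_subtractf sum_distrib_left mult.assoc)
    qed
    have "\<omega>' \<in> annihilating_weights I K h"
      using w nonneg sums[of "\<lambda>_. 1"] c1 sums ck S(2)
      by (auto simp: annihilating_weights_def \<omega>'_def)
    moreover have "supp \<omega>' \<subset> S"
    proof
      show "supp \<omega>' \<subseteq> S"
        by (auto simp: supp_def \<omega>'_def S_def split: if_splits)
      have "\<omega>' y = 0"
        using \<open>y \<in> S\<close> \<open>0 < c y\<close> by (simp add: \<omega>'_def t_def)
      then show "supp \<omega>' \<noteq> S"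
        using \<open>y \<in> S\<close> by (auto simp: supp_def)
    qed
    then have "card (supp \<omega>') < card S"
      by (rule psubset_card_mono[OF S(1)])
    ultimately show False
      using least S_def leD by blast
  qed
  then show ?thesis
    using w by (auto simp: S_def supp_def)
qed

section \<open>Perturbation of a local minimax approximant\<close>

text \<open>The competitors need not be in lowest terms. A common factor of \<open>P\<close> and
  \<open>Q\<close> is nonzero at \<open>x\<close> because \<open>Q\<close> is, so it cancels from
  the value.\<close>

lemma rat_eval_Fract:
  assumes "poly Q x \<noteq> 0"
  shows "\<not> rat_pole (Fraction_Field.Fract P Q) x"
    and "rat_eval (Fraction_Field.Fract P Q) x = poly P x / poly Q x"
proof -
  have "Q \<noteq> 0"
    using assms by auto
  then have qf: "quot_of_fract (Fraction_Field.Fract P Q) = normalize_quot (P, Q)"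
    using quot_of_fract_quot_to_fract[of "(P, Q)"] by (simp add: quot_to_fract_def)
  obtain e where e: "P = fst (normalize_quot (P, Q)) * e" "Q = snd (normalize_quot (P, Q)) * e"
    by (rule normalize_quotE[OF \<open>Q \<noteq> 0\<close>])
  have P: "poly P x = poly (fst (normalize_quot (P, Q))) x * poly e x"
    by (subst e(1)) simp
  have Q: "poly Q x = poly (snd (normalize_quot (P, Q))) x * poly e x"
    by (subst e(2)) simp
  show "\<not> rat_pole (Fraction_Field.Fract P Q) x"
    using assms Q by (auto simp: rat_pole_def qf)
  show "rat_eval (Fraction_Field.Fract P Q) x = poly P x / poly Q x"
    using assms Q by (simp add: rat_eval_def qf P)
qed

section \<open>Representing polynomials as \<open>t * p - s * q\<close> with bounded degrees\<close>

text \<open>A Bezout identity is multiplied by \<open>g\<close>; the coefficient of \<open>p\<close>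
  is then reduced modulo \<open>q\<close>, the quotient being moved into \<open>s\<close>.\<close>

lemma bezout_poly_reduced:
  fixes p q g :: "'a::field_gcd poly"
  assumes "coprime p q" "q \<noteq> 0"
  obtains s t where "g = t * p - s * q" "degree t \<le> degree q"
proof -
  obtain a b where ab: "a * p + b * q = 1"
    using assms(1) bezout_coefficients_fst_snd[of p q] by (metis coprime_imp_gcd_eq_1)
  define t where "t = (g * a) mod q"
  define c where "c = (g * a) div q"
  define s where "s = - (g * b + c * p)"
  have "t * p - s * q = (c * q + t) * p + g * b * q"
    by (simp add: s_def algebra_simps)
  also have "\<dots> = g * (a * p + b * q)"
    unfolding c_def t_def div_mult_mod_eq
    by (simp add: algebra_simps)
  finally have "g = t * p - s * q"
    by (simp add: ab)
  moreover have "degree t \<le> degree q"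
    using degree_mod_less[OF assms(2), of "g * a"] by (auto simp: t_def)
  ultimately show thesis
    using that by blast
qed

lemma degree_le_of_mult:
  fixes s q :: "'a::idom poly"
  assumes "q \<noteq> 0" "degree (s * q) \<le> k + degree q"
  shows "degree s \<le> k"
  using assms by (cases "s = 0") (auto simp: degree_mult_eq)

text \<open>The defect is the smaller of the two degree gaps. If it is the gap of \<open>q\<close>,
  then \<open>n\<close> equals \<open>n1 + degree q\<close>; \<open>t\<close> is reduced modulo
  \<open>q\<close> and comparing degrees in \<open>s * q = t * p - g\<close> bounds
  \<open>s\<close>. Otherwise \<open>n\<close> equals \<open>n2 + degree p\<close> and the roles of
  \<open>p\<close> and \<open>q\<close> are exchanged.\<close>

lemma poly_space_eq_combinations:
  assumes p: "p \<in> poly_space n1" and q: "q \<in> poly_space n2" and "q \<noteq> 0" "coprime p q"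
    and g: "g \<in> poly_space (n1 + n2 - defect n1 n2 p q)"
  obtains s t where "s \<in> poly_space n1" "t \<in> poly_space n2" "g = t * p - s * q"
proof (cases "p = 0 \<or> n2 - degree q \<le> n1 - degree p")
  case True
  obtain s t where st: "g = t * p - s * q" "degree t \<le> degree q"
    using bezout_poly_reduced[OF \<open>coprime p q\<close> \<open>q \<noteq> 0\<close>] by blast
  have "n1 + n2 - defect n1 n2 p q = n1 + degree q"
    using q True by (auto simp: poly_space_def defect_def)
  then have "degree g \<le> n1 + degree q"
    using g by (simp add: poly_space_def)
  moreover have "degree (t * p) \<le> n1 + degree q"
    using degree_mult_le[of t p] st(2) p by (simp add: poly_space_def)
  moreover have "s * q = t * p - g"
    by (simp add: st(1))
  ultimately have "degree s \<le> n1"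
    using degree_le_of_mult[OF \<open>q \<noteq> 0\<close>] degree_diff_le by metis
  then show thesis
    using that[of s t] st q by (simp add: poly_space_def)
next
  case False
  then have "p \<noteq> 0"
    by simp
  obtain s t where st: "- g = s * q - t * p" "degree s \<le> degree p"
    using bezout_poly_reduced[of q p "- g"] \<open>coprime p q\<close> \<open>p \<noteq> 0\<close> by (metis coprime_commute)
  have g_eq: "g = t * p - s * q"
    using st(1) by (metis minus_diff_eq minus_minus)
  have "n1 + n2 - defect n1 n2 p q = n2 + degree p"
    using p False by (auto simp: poly_space_def defect_def)
  then have "degree g \<le> n2 + degree p"
    using g by (simp add: poly_space_def)
  moreover have "degree (s * q) \<le> n2 + degree p"
    using degree_mult_le[of s q] st(2) q by (simp add: poly_space_def)
  moreover have "t * p = g + s * q"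
    by (simp add: g_eq)
  ultimately have "degree t \<le> n2"
    using degree_le_of_mult[OF \<open>p \<noteq> 0\<close>] degree_add_le by metis
  then show thesis
    using that[of s t] g_eq st(2) p by (auto simp: poly_space_def)
qed

section \<open>Second-order comparison along a curve of competitors\<close>

lemma cmod_quadratic_expansion:
  "(cmod (a + of_real \<epsilon> * b + of_real (\<epsilon>\<^sup>2) * c))\<^sup>2 =
     (cmod a)\<^sup>2 + \<epsilon> * (2 * Re (cnj a * b)) + \<epsilon>\<^sup>2 * ((cmod b)\<^sup>2 + 2 * Re (cnj a * c) +
       \<epsilon> * (2 * Re (cnj b * c)) + \<epsilon>\<^sup>2 * (cmod c)\<^sup>2)"
  unfolding cmod_power2 by (simp add: power2_eq_square algebra_simps)

text \<open>The constant and linear terms of the two squared moduli agree. The remainder divided by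
  \<epsilon>^2 is continuous, so the strict inequality between the second-order coefficients
  persists for small \<epsilon> > 0.\<close>

lemma eventually_cmod_quadratic_less:
  assumes "Re (cnj a * b) = Re (cnj a * b')"
    and "(cmod b)\<^sup>2 + 2 * Re (cnj a * c) < (cmod b')\<^sup>2 + 2 * Re (cnj a * c')"
  shows "\<forall>\<^sub>F \<epsilon> in at_right 0.
    cmod (a + of_real \<epsilon> * b + of_real (\<epsilon>\<^sup>2) * c) < cmod (a + of_real \<epsilon> * b' + of_real (\<epsilon>\<^sup>2) * c')"
proof -
  define r where "r b c \<epsilon> = (cmod b)\<^sup>2 + 2 * Re (cnj a * c) +
       \<epsilon> * (2 * Re (cnj b * c)) + \<epsilon>\<^sup>2 * (cmod c)\<^sup>2" for b c \<epsilon>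
  have "((\<lambda>\<epsilon>. r b' c' \<epsilon> - r b c \<epsilon>) \<longlongrightarrow> r b' c' 0 - r b c 0) (at_right 0)"
    unfolding r_def by (intro tendsto_intros)
  moreover have "0 < r b' c' 0 - r b c 0"
    using assms(2) by (simp add: r_def)
  ultimately have "\<forall>\<^sub>F \<epsilon> in at_right 0. 0 < r b' c' \<epsilon> - r b c \<epsilon>"
    by (rule order_tendstoD)
  moreover have "\<forall>\<^sub>F \<epsilon> in at_right 0. 0 < (\<epsilon>::real)"
    by (simp add: eventually_at_right_less)
  ultimately show ?thesis
  proof eventually_elim
    case (elim \<epsilon>)
    then have "\<epsilon>\<^sup>2 * r b c \<epsilon> < \<epsilon>\<^sup>2 * r b' c' \<epsilon>"
      by simp
    then have "(cmod (a + of_real \<epsilon> * b + of_real (\<epsilon>\<^sup>2) * c))\<^sup>2 < (cmod (a + of_real \<epsilon> * b' + of_real (\<epsilon>\<^sup>2) * c'))\<^sup>2"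
      unfolding cmod_quadratic_expansion assms(1) r_def by linarith
    then show ?case
      by (rule power2_less_imp_less) simp
  qed
qed

lemma poly_space_perturbation:
  assumes "p \<in> poly_space k" "s \<in> poly_space k" "u \<in> poly_space k"
  shows "p + Polynomial.smult a s + Polynomial.smult b u \<in> poly_space k"
  using assms unfolding poly_space_def
  by (auto intro!: degree_add_le intro: order_trans[OF degree_smult_le])

lemma sup_norm_less_iff:
  assumes "finite X" "X \<noteq> {}"
  shows "sup_norm X h < b \<longleftrightarrow> (\<forall>x\<in>X. cmod (h x) < b)"
  using assms by (simp add: sup_norm_def)

lemma local_minimax_no_pole:
  assumes "local_minimax n1 n2 X f \<xi>" "irreducible_repr \<xi> p q" "x \<in> X"
  shows "poly q x \<noteq> 0"
  using assms irreducible_repr_rat_pole[OF assms(2)]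
  by (auto simp: local_minimax_def rat_error_def split: if_splits)

text \<open>Along the curve of competitors, the squared error at an extreme point, multiplied by the
  squared modulus of the denominator, changes by
  \<open>\<epsilon> \<cdot> kappa s t + \<epsilon>\<^sup>2 \<cdot> (rho s t + kappa u w) + O(\<epsilon>\<^sup>3)\<close>
  relative to the error of \<open>\<xi>\<close> with the same factor.\<close>

lemma local_minimax_second_order:
  assumes X: "finite X" "X \<noteq> {}" and lm: "local_minimax n1 n2 X f \<xi>" and irr: "irreducible_repr \<xi> p q"
    and pq: "p \<in> poly_space n1" "q \<in> poly_space n2"
    and su: "s \<in> poly_space n1" "u \<in> poly_space n1" and tw: "t \<in> poly_space n2" "w \<in> poly_space n2"
    and kappa0: "\<And>x. x \<in> extreme_points X f \<xi> \<Longrightarrow> kappa f \<xi> p q s t x = 0"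
  shows "\<exists>x\<in>extreme_points X f \<xi>. 0 \<le> rho f \<xi> s t x + kappa f \<xi> p q u w x"
proof (rule ccontr)
  assume neg: "\<not> ?thesis"
  define M where "M = sup_norm X (err f \<xi>)"
  define P where "P \<epsilon> = p + Polynomial.smult (of_real \<epsilon>) s + Polynomial.smult (of_real (\<epsilon>\<^sup>2)) u" for \<epsilon>
  define Q where "Q \<epsilon> = q + Polynomial.smult (of_real \<epsilon>) t + Polynomial.smult (of_real (\<epsilon>\<^sup>2)) w" for \<epsilon>
  have qnz: "poly q x \<noteq> 0" if "x \<in> X" for x
    using local_minimax_no_pole[OF lm irr that] .
  note eval = irreducible_repr_rat_eval[OF irr]
  obtain \<delta> where "0 < \<delta>" and opt: "\<And>\<eta>. \<eta> \<in> ratfuns n1 n2 \<Longrightarrow> rat_error X (rat_eval \<xi>) \<eta> < ereal \<delta> \<Longrightarrow>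
      rat_error X f \<xi> \<le> rat_error X f \<eta>"
    using lm by (auto simp: local_minimax_def)
  have limP: "((\<lambda>\<epsilon>. poly (P \<epsilon>) x) \<longlongrightarrow> poly p x) (at_right 0)" for x
    by (auto simp: P_def intro!: tendsto_eq_intros)
  have limQ: "((\<lambda>\<epsilon>. poly (Q \<epsilon>) x) \<longlongrightarrow> poly q x) (at_right 0)" for x
    by (auto simp: Q_def intro!: tendsto_eq_intros)
  have Qnz: "\<forall>\<^sub>F \<epsilon> in at_right 0. poly (Q \<epsilon>) x \<noteq> 0" if "x \<in> X" for x
    using tendsto_imp_eventually_ne[OF limQ qnz[OF that]] .
  have lim: "((\<lambda>\<epsilon>. poly (P \<epsilon>) x / poly (Q \<epsilon>) x) \<longlongrightarrow> rat_eval \<xi> x) (at_right 0)" if "x \<in> X" for x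
    unfolding eval using qnz[OF that] by (intro tendsto_divide limP limQ)
  have close: "\<forall>\<^sub>F \<epsilon> in at_right 0. cmod (rat_eval \<xi> x - poly (P \<epsilon>) x / poly (Q \<epsilon>) x) < \<delta>"
    if "x \<in> X" for x
    using tendstoD[OF lim[OF that] \<open>0 < \<delta>\<close>] by (simp add: dist_norm norm_minus_commute)
  \<comment> \<open>Away from the extreme points the error of \<open>\<xi>\<close> is strictly below
    \<open>M\<close>, so continuity is enough; only the extreme points need the expansion.\<close>
  have better: "\<forall>\<^sub>F \<epsilon> in at_right 0. cmod (f x - poly (P \<epsilon>) x / poly (Q \<epsilon>) x) < M" if "x \<in> X" for x
  proof (cases "x \<in> extreme_points X f \<xi>")
    case False
    have "cmod (err f \<xi> x) \<le> M"
      using X that by (auto simp: M_def sup_norm_def)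
    then have less: "cmod (err f \<xi> x) < M"
      using False that by (auto simp: extreme_points_def M_def)
    have "((\<lambda>\<epsilon>. cmod (f x - poly (P \<epsilon>) x / poly (Q \<epsilon>) x)) \<longlongrightarrow> cmod (err f \<xi> x)) (at_right 0)"
      unfolding err_def by (intro tendsto_intros lim that)
    then show ?thesis
      using less by (rule order_tendstoD)
  next
    case True
    define e where "e = err f \<xi> x"
    \<comment> \<open>After multiplication by the denominator, \<open>f Q - P\<close> and
      \<open>e Q\<close> have the same value \<open>a\<close> at \<epsilon> = 0.\<close>
    define a where "a = e * poly q x"
    have e: "cmod e = M"
      using True by (simp add: e_def M_def extreme_points_def)
    have f: "f x = e + poly p x / poly q x"
      by (simp add: e_def err_def eval)
    have kap: "kappa f \<xi> p q s t x = 2 * (Re (cnj a * (f x * poly t x - poly s x)) - Re (cnj a * (e * poly t x)))"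
      for s t
    proof -
      have "poly (t * p - s * q) x / poly q x = (f x * poly t x - poly s x) - e * poly t x"
        using qnz[OF that] by (simp add: f diff_divide_distrib distrib_right)
      then show ?thesis
        by (simp add: kappa_def a_def e_def right_diff_distrib)
    qed
    \<comment> \<open>The linear coefficients of the two expansions differ by
      \<open>kappa s t\<close>, which is 0, and the second-order ones by
      \<open>rho s t + kappa u w\<close>, which is negative by assumption.\<close>
    have "rho f \<xi> s t x = (cmod (f x * poly t x - poly s x))\<^sup>2 - (cmod (e * poly t x))\<^sup>2"
      by (simp add: rho_def e_def err_def left_diff_distrib)
    then have "\<forall>\<^sub>F \<epsilon> in at_right 0.
        cmod (a + of_real \<epsilon> * (f x * poly t x - poly s x) + of_real (\<epsilon>\<^sup>2) * (f x * poly w x - poly u x))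
          < cmod (a + of_real \<epsilon> * (e * poly t x) + of_real (\<epsilon>\<^sup>2) * (e * poly w x))"
      using kappa0[OF True] neg True kap[of s t] kap[of u w]
      by (intro eventually_cmod_quadratic_less) (auto simp: not_le)
    moreover note Qnz[OF that]
    ultimately show ?thesis
    proof eventually_elim
      case (elim \<epsilon>)
      have "a + of_real \<epsilon> * (f x * poly t x - poly s x) + of_real (\<epsilon>\<^sup>2) * (f x * poly w x - poly u x) =
          (f x - poly (P \<epsilon>) x / poly (Q \<epsilon>) x) * poly (Q \<epsilon>) x"
      proof -
        have "a = f x * poly q x - poly p x"
          using qnz[OF that] by (simp add: a_def f distrib_right)
        then have "a + of_real \<epsilon> * (f x * poly t x - poly s x) + of_real (\<epsilon>\<^sup>2) * (f x * poly w x - poly u x) =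
            f x * poly (Q \<epsilon>) x - poly (P \<epsilon>) x"
          by (simp add: P_def Q_def algebra_simps)
        then show ?thesis
          using elim(2) by (simp add: left_diff_distrib)
      qed
      moreover have "a + of_real \<epsilon> * (e * poly t x) + of_real (\<epsilon>\<^sup>2) * (e * poly w x) = e * poly (Q \<epsilon>) x"
        by (simp add: a_def Q_def algebra_simps)
      ultimately have "cmod (f x - poly (P \<epsilon>) x / poly (Q \<epsilon>) x) * cmod (poly (Q \<epsilon>) x) < M * cmod (poly (Q \<epsilon>) x)"
        using elim(1) e by (simp add: norm_mult)
      then show ?case
        using elim(2) by simp
    qed
  qed
  have "\<forall>\<^sub>F \<epsilon> in at_right 0. \<forall>x\<in>X. poly (Q \<epsilon>) x \<noteq> 0 \<and>
      cmod (rat_eval \<xi> x - poly (P \<epsilon>) x / poly (Q \<epsilon>) x) < \<delta> \<and> cmod (f x - poly (P \<epsilon>) x / poly (Q \<epsilon>) x) < M"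
    using Qnz close better by (intro eventually_ball_finite X ballI) (simp add: eventually_conj)
  then obtain \<epsilon> :: real where \<epsilon>: "\<forall>x\<in>X. poly (Q \<epsilon>) x \<noteq> 0 \<and>
      cmod (rat_eval \<xi> x - poly (P \<epsilon>) x / poly (Q \<epsilon>) x) < \<delta> \<and> cmod (f x - poly (P \<epsilon>) x / poly (Q \<epsilon>) x) < M"
    using eventually_happens' trivial_limit_at_right_real by blast
  \<comment> \<open>Since \<open>X\<close> is finite, one \<epsilon> serves all points. This
    competitor is closer than \<delta> to \<open>\<xi>\<close> and has error below
    \<open>M\<close>.\<close>
  define \<eta> where "\<eta> = Fraction_Field.Fract (P \<epsilon>) (Q \<epsilon>)"
  have \<eta>: "\<not> rat_pole \<eta> x" "rat_eval \<eta> x = poly (P \<epsilon>) x / poly (Q \<epsilon>) x" if "x \<in> X" for x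
    using rat_eval_Fract \<epsilon> that by (auto simp: \<eta>_def)
  have "Q \<epsilon> \<noteq> 0"
    using \<epsilon> X(2) by auto
  moreover have "P \<epsilon> \<in> poly_space n1" "Q \<epsilon> \<in> poly_space n2"
    unfolding P_def Q_def using pq su tw by (auto intro: poly_space_perturbation)
  ultimately have "\<eta> \<in> ratfuns n1 n2"
    by (auto simp: ratfuns_def \<eta>_def)
  moreover have "rat_error X (rat_eval \<xi>) \<eta> < ereal \<delta>"
    using \<eta> \<epsilon> X by (simp add: rat_error_def sup_norm_less_iff)
  ultimately have "rat_error X f \<xi> \<le> rat_error X f \<eta>"
    by (rule opt)
  moreover have "rat_error X f \<xi> = ereal M"
    using qnz irreducible_repr_rat_pole[OF irr] by (auto simp: rat_error_def M_def err_def[abs_def])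
  moreover have "rat_error X f \<eta> < ereal M"
    using \<eta> \<epsilon> X by (simp add: rat_error_def sup_norm_less_iff)
  ultimately show False
    by simp
qed

section \<open>The weights of the linear program\<close>

lemma poly_space_basis_memb:
  assumes "poly_space_basis n \<pi>" "k \<le> n"
  shows "\<pi> k \<in> poly_space n"
proof -
  interpret vs: Vector_Spaces.vector_space "Polynomial.smult :: complex \<Rightarrow> complex poly \<Rightarrow> _"
    by (rule vector_space_smult)
  show ?thesis
    using assms vs.span_base[of "\<pi> k" "\<pi> ` {..n}"] by (auto simp: poly_space_basis_def)
qed

lemma poly_space_basis_combination:
  assumes "poly_space_basis n \<pi>" "g \<in> poly_space n"
  obtains c where "g = (\<Sum>k\<le>n. Polynomial.smult (c k) (\<pi> k))"
proof -
  interpret vs: Vector_Spaces.vector_space "Polynomial.smult :: complex \<Rightarrow> complex poly \<Rightarrow> _"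
    by (rule vector_space_smult)
  have "g \<in> range (\<lambda>u. \<Sum>v\<in>\<pi> ` {..n}. Polynomial.smult (u v) v)"
    using assms by (simp add: poly_space_basis_def flip: vs.span_finite)
  then obtain u where "g = (\<Sum>v\<in>\<pi> ` {..n}. Polynomial.smult (u v) v)"
    by auto
  also have "\<dots> = (\<Sum>k\<le>n. Polynomial.smult (u (\<pi> k)) (\<pi> k))"
    using assms(1) by (subst sum.reindex) (auto simp: poly_space_basis_def)
  finally show thesis
    by (rule that)
qed

lemma poly_space_sum_smult:
  assumes "\<And>k. k \<in> K \<Longrightarrow> \<pi> k \<in> poly_space n" "finite K"
  shows "(\<Sum>k\<in>K. Polynomial.smult (c k) (\<pi> k)) \<in> poly_space n"
  using assms unfolding poly_space_def
  by (auto intro!: degree_sum_le order_trans[OF degree_smult_le])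

text \<open>With at most \<open>n + 1\<close> points, the product of the linear factors at all
  points other than \<open>z i\<close> lies in \<open>poly_space n\<close> and isolates the nonzero
  term of \<open>i\<close>.\<close>

lemma annihilator_poly_space_card:
  fixes z :: "'a \<Rightarrow> complex"
  assumes "finite S" "inj_on z S" "i \<in> S" "a i \<noteq> 0"
    and ann: "\<And>g. g \<in> poly_space n \<Longrightarrow> (\<Sum>j\<in>S. a j * poly g (z j)) = 0"
  shows "n + 2 \<le> card S"
proof (rule ccontr)
  assume small: "\<not> ?thesis"
  define g where "g = (\<Prod>j\<in>S - {i}. [:- z j, 1:])"
  have "degree g \<le> (\<Sum>j\<in>S - {i}. degree [:- z j, 1:])"
    unfolding g_def using degree_prod_sum_le assms(1) by (metis (no_types, lifting) comp_apply finite_Diff sum.cong)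
  then have "g \<in> poly_space n"
    using small assms(1,3) by (simp add: poly_space_def)
  then have "0 = (\<Sum>j\<in>S. a j * poly g (z j))"
    by (simp add: ann)
  also have "\<dots> = (\<Sum>j\<in>{i}. a j * poly g (z j))"
    using assms(1,3) by (intro sum.mono_neutral_right) (auto simp: g_def poly_prod)
  also have "\<dots> = a i * (\<Prod>j\<in>S - {i}. z i - z j)"
    by (simp add: g_def poly_prod)
  also have "\<dots> \<noteq> 0"
    using assms(1-4) by (auto simp: inj_on_def)
  finally show False
    by simp
qed

text \<open>The columns of \<open>Re_neg_Im_mat A\<close>: \<open>(k, False)\<close> is column \<open>k\<close> of the real block,
  \<open>(k, True)\<close> is column \<open>k\<close> of the imaginary block.\<close>

definition Re_neg_Im_col :: "complex mat \<Rightarrow> nat \<times> bool \<Rightarrow> nat \<Rightarrow> real" where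
  "Re_neg_Im_col A = (\<lambda>(k, b) i. if b then - Im (A $$ (i, k)) else Re (A $$ (i, k)))"

abbreviation Re_neg_Im_weights :: "complex mat \<Rightarrow> (nat \<Rightarrow> real) set" where
  "Re_neg_Im_weights A \<equiv>
     annihilating_weights {..<dim_row A} ({..<dim_col A} \<times> UNIV) (Re_neg_Im_col A)"

section \<open>The matrix program as a set of annihilating weights\<close>

lemma dim_Re_neg_Im_mat [simp]:
  "dim_row (Re_neg_Im_mat A) = dim_row A" "dim_col (Re_neg_Im_mat A) = 2 * dim_col A"
  by (simp_all add: Re_neg_Im_mat_def)

lemma index_Re_neg_Im_mat:
  assumes "i < dim_row A" "j < 2 * dim_col A"
  shows "Re_neg_Im_mat A $$ (i, j) =
    (if j < dim_col A then Re_neg_Im_col A (j, False) i else Re_neg_Im_col A (j - dim_col A, True) i)"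
  using assms by (auto simp: Re_neg_Im_mat_def Re_neg_Im_col_def)

lemma transpose_Re_neg_Im_mat_mult_eq_0_iff:
  assumes "v \<in> carrier_vec (dim_row A)"
  shows "transpose_mat (Re_neg_Im_mat A) *\<^sub>v v = 0\<^sub>v (2 * dim_col A) \<longleftrightarrow>
    (\<forall>k\<in>{..<dim_col A} \<times> UNIV. (\<Sum>i<dim_row A. v $ i * Re_neg_Im_col A k i) = 0)"
    (is "?l \<longleftrightarrow> ?r")
proof -
  define m where "m = dim_col A"
  define \<sigma> where "\<sigma> k = (\<Sum>i<dim_row A. v $ i * Re_neg_Im_col A k i)" for k
  have "(transpose_mat (Re_neg_Im_mat A) *\<^sub>v v) $ j = (if j < m then \<sigma> (j, False) else \<sigma> (j - m, True))"
    if "j < 2 * m" for j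
  proof -
    have "(transpose_mat (Re_neg_Im_mat A) *\<^sub>v v) $ j = (\<Sum>i<dim_row A. Re_neg_Im_mat A $$ (i, j) * v $ i)"
      using assms that by (simp add: m_def scalar_prod_def lessThan_atLeast0)
    then show ?thesis
      using that by (simp add: index_Re_neg_Im_mat m_def \<sigma>_def mult.commute)
  qed
  moreover have "?l \<longleftrightarrow> (\<forall>j<2 * m. (transpose_mat (Re_neg_Im_mat A) *\<^sub>v v) $ j = 0)"
  proof
    assume ?l
    then show "\<forall>j<2 * m. (transpose_mat (Re_neg_Im_mat A) *\<^sub>v v) $ j = 0"
      by (simp add: m_def del: index_mult_mat_vec)
  qed (intro eq_vecI; simp add: m_def del: index_mult_mat_vec)
  ultimately have "?l \<longleftrightarrow> (\<forall>j<2 * m. (if j < m then \<sigma> (j, False) else \<sigma> (j - m, True)) = 0)"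
    by simp
  also have "\<dots> \<longleftrightarrow> (\<forall>k<m. \<sigma> (k, False) = 0 \<and> \<sigma> (k, True) = 0)"
  proof (intro iffI allI impI conjI)
    fix k assume *: "\<forall>j<2 * m. (if j < m then \<sigma> (j, False) else \<sigma> (j - m, True)) = 0" and "k < m"
    show "\<sigma> (k, False) = 0" "\<sigma> (k, True) = 0"
      \<comment> \<open>Column \<open>k + m\<close> is the imaginary counterpart of column
        \<open>k\<close>.\<close>
      using *[rule_format, of k] *[rule_format, of "k + m"] \<open>k < m\<close> by simp_all
  qed auto
  also have "\<dots> \<longleftrightarrow> ?r"
    by (auto simp: m_def \<sigma>_def UNIV_bool)
  finally show ?thesis .
qed

text \<open>This carries the duality and compactness results for weight functions over to the matrix
  program.\<close>

lemma feasible_weights_Re_neg_Im_mat: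
  "feasible_weights (Re_neg_Im_mat A) = Matrix.vec (dim_row A) ` Re_neg_Im_weights A"
proof (intro equalityI subsetI)
  fix v assume v: "v \<in> feasible_weights (Re_neg_Im_mat A)"
  \<comment> \<open>Vector entries beyond the dimension are unspecified, hence the explicit
    extension by 0.\<close>
  define \<omega> where "\<omega> i = (if i < dim_row A then v $ i else 0)" for i
  have "v \<in> carrier_vec (dim_row A)"
    using v by (simp add: feasible_weights_def)
  then have "v = Matrix.vec (dim_row A) \<omega>"
    by (auto simp: \<omega>_def)
  moreover have "\<omega> \<in> Re_neg_Im_weights A"
    using v transpose_Re_neg_Im_mat_mult_eq_0_iff[of v A]
    by (auto simp: feasible_weights_def annihilating_weights_def \<omega>_def scalar_prod_def lessThan_atLeast0)
  ultimately show "v \<in> Matrix.vec (dim_row A) ` Re_neg_Im_weights A"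
    by blast
next
  fix v assume "v \<in> Matrix.vec (dim_row A) ` Re_neg_Im_weights A"
  then obtain \<omega> where "\<omega> \<in> Re_neg_Im_weights A" "v = Matrix.vec (dim_row A) \<omega>"
    by blast
  then show "v \<in> feasible_weights (Re_neg_Im_mat A)"
    using transpose_Re_neg_Im_mat_mult_eq_0_iff[of v A]
    by (auto simp: feasible_weights_def annihilating_weights_def scalar_prod_def lessThan_atLeast0)
qed

lemma objective_values_Re_neg_Im_mat:
  assumes "d = dim_row A"
  shows "objective_values (Re_neg_Im_mat A) (Matrix.vec d r) = (\<lambda>\<omega>. \<Sum>i<d. \<omega> i * r i) ` Re_neg_Im_weights A"
proof -
  have "objective_values (Re_neg_Im_mat A) (Matrix.vec d r) =
      (\<lambda>v. scalar_prod v (Matrix.vec d r)) ` feasible_weights (Re_neg_Im_mat A)"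
    by (auto simp: objective_values_def)
  also have "\<dots> = (\<lambda>\<omega>. \<Sum>i<d. \<omega> i * r i) ` Re_neg_Im_weights A"
    unfolding feasible_weights_Re_neg_Im_mat image_image
    by (intro image_cong refl) (simp add: assms scalar_prod_def lessThan_atLeast0)
  finally show ?thesis .
qed

text \<open>As the weights are real, the two real equations for index \<open>k\<close> are the real
  part and the negated imaginary part of one complex equation.\<close>

lemma Re_neg_Im_weights_iff:
  "\<omega> \<in> Re_neg_Im_weights A \<longleftrightarrow>
     (\<forall>i<dim_row A. 0 \<le> \<omega> i) \<and> (\<forall>i\<ge>dim_row A. \<omega> i = 0) \<and> (\<Sum>i<dim_row A. \<omega> i) = 1 \<and>
     (\<forall>k<dim_col A. (\<Sum>i<dim_row A. of_real (\<omega> i) * A $$ (i, k)) = 0)"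
  by (auto simp: annihilating_weights_def Re_neg_Im_col_def complex_eq_iff sum_negf not_less UNIV_bool
      simp flip: not_le)

lemma scaled_basis_mat_dim [simp]:
  "dim_row (scaled_basis_mat f \<xi> q d n z \<pi>) = d" "dim_col (scaled_basis_mat f \<xi> q d n z \<pi>) = n + 1"
  by (simp_all add: scaled_basis_mat_def basis_mat_def mat_diag_def)

lemma scaled_basis_mat_index:
  assumes "i < d" "k < n + 1"
  shows "scaled_basis_mat f \<xi> q d n z \<pi> $$ (i, k) = tau f \<xi> q (z i) * poly (\<pi> k) (z i)"
  using assms unfolding scaled_basis_mat_def basis_mat_def
  by (subst mat_diag_mult_left) auto

lemma Re_tau_mult:
  "Re (tau f \<xi> q x * y) = 2 * Re (cnj ((f x - rat_eval \<xi> x) * poly q x) * (y / poly q x))"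
proof -
  have "tau f \<xi> q x * y = 2 * (cnj ((f x - rat_eval \<xi> x) * poly q x) * (y / poly q x))"
    by (simp add: tau_def err_def)
  moreover have "Re (2 * w) = 2 * Re w" for w
    by simp
  ultimately show ?thesis
    by (simp only:)
qed

text \<open>\<open>kappa\<close> depends on the direction only through
  \<open>g = t * p - s * q\<close>, real-linearly; this links the perturbation argument to the rows
  of the scaled basis matrix.\<close>

lemma kappa_eq_tau: "kappa f \<xi> p q s t x = Re (tau f \<xi> q x * poly (t * p - s * q) x)"
  unfolding kappa_def Re_tau_mult err_def ..

theorem theorem2p3:
  fixes n1 n2 n d :: nat
    and X :: "complex set"
    and f :: "complex \<Rightarrow> complex"
    and \<xi> :: "complex poly fract"
    and p q :: "complex poly"
    and z :: "nat \<Rightarrow> complex"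
    and \<pi> :: "nat \<Rightarrow> complex poly"
  assumes "finite X"
    and "card X \<ge> n1 + n2 + 2"
    and "\<not> (\<exists>\<eta>\<in>ratfuns n1 n2. agrees_on X f \<eta>)"
    and "\<xi> \<in> ratfuns n1 n2"
    and "p \<in> poly_space n1"
    and "q \<in> poly_space n2"
    and "irreducible_repr \<xi> p q"
    and "local_minimax n1 n2 X f \<xi>"
    and "n = n1 + n2 - defect n1 n2 p q"
    and "d = card (extreme_points X f \<xi>)"
    and "bij_betw z {..<d} (extreme_points X f \<xi>)"
    and "poly_space_basis n \<pi>"
  shows
    "(\<forall>g\<in>poly_space n.
        (MAX x\<in>extreme_points X f \<xi>.
           Re (cnj ((f x - rat_eval \<xi> x) * poly q x) * (poly g x / poly q x))) \<ge> 0)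
     \<and>
     (\<exists>(r::nat) (y :: nat \<Rightarrow> complex) (\<omega> :: nat \<Rightarrow> real).
        n + 2 \<le> r \<and> r \<le> 2 * n + 3 \<and>
        inj_on y {..<r} \<and> y ` {..<r} \<subseteq> extreme_points X f \<xi> \<and>
        (\<forall>j<r. \<omega> j > 0) \<and> (\<Sum>j<r. \<omega> j) = 1 \<and>
        (\<forall>g\<in>poly_space n.
           (\<Sum>j<r. complex_of_real (\<omega> j) * cnj ((f (y j) - rat_eval \<xi> (y j)) * poly q (y j))
                     * poly g (y j) / poly q (y j)) = 0))
     \<and>
     (\<forall>(s, t)\<in>critical_directions n1 n2 X f \<xi> p q.
        \<exists>M\<in>objective_values (Re_neg_Im_mat (scaled_basis_mat f \<xi> q d n z \<pi>)) (rho_vec f \<xi> s t d z).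
          (\<forall>v\<in>objective_values (Re_neg_Im_mat (scaled_basis_mat f \<xi> q d n z \<pi>)) (rho_vec f \<xi> s t d z).
             v \<le> M) \<and> M \<ge> 0)"
proof -
  note X = \<open>finite X\<close> and lm = \<open>local_minimax n1 n2 X f \<xi>\<close> and irr = \<open>irreducible_repr \<xi> p q\<close>
    and p = \<open>p \<in> poly_space n1\<close> and q = \<open>q \<in> poly_space n2\<close> and basis = \<open>poly_space_basis n \<pi>\<close>
    and n = \<open>n = n1 + n2 - defect n1 n2 p q\<close> and z = \<open>bij_betw z {..<d} (extreme_points X f \<xi>)\<close>
  define A where "A = scaled_basis_mat f \<xi> q d n z \<pi>"
  define W where "W = Re_neg_Im_weights A"
  define \<tau> where "\<tau> = tau f \<xi> q"
  have dimA: "dim_row A = d" "dim_col A = Suc n"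
    by (simp_all add: A_def)
  have W_iff: "\<omega> \<in> W \<longleftrightarrow> (\<forall>i<d. 0 \<le> \<omega> i) \<and> (\<forall>i\<ge>d. \<omega> i = 0) \<and> (\<Sum>i<d. \<omega> i) = 1 \<and>
      (\<forall>k\<le>n. (\<Sum>i<d. of_real (\<omega> i) * A $$ (i, k)) = 0)" for \<omega>
    unfolding W_def Re_neg_Im_weights_iff by (simp add: dimA less_Suc_eq_le)
  have A_index: "A $$ (i, k) = \<tau> (z i) * poly (\<pi> k) (z i)" if "i < d" "k \<le> n" for i k
    using that by (simp add: A_def \<tau>_def scaled_basis_mat_index)
  have X_ne: "X \<noteq> {}"
    using \<open>card X \<ge> n1 + n2 + 2\<close> by auto
  have qnz: "poly q x \<noteq> 0" if "x \<in> X" for x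
    using local_minimax_no_pole[OF lm irr that] .
  have E_sub: "extreme_points X f \<xi> \<subseteq> X"
    by (auto simp: extreme_points_def)
  have E_fin: "finite (extreme_points X f \<xi>)"
    using X E_sub by (rule finite_subset[rotated])
  have cop: "coprime p q" "q \<noteq> 0"
    using irr by (auto simp: irreducible_repr_def)
  have zE: "z i \<in> extreme_points X f \<xi>" if "i < d" for i
    using z that by (auto simp: bij_betw_def)

  \<comment> \<open>Optimality conditions and their dual weights\<close>
  have dual: "\<exists>x\<in>extreme_points X f \<xi>. 0 \<le> rho f \<xi> s t x + Re (\<tau> x * poly g x)"
    if st: "(s, t) \<in> critical_directions n1 n2 X f \<xi> p q" and g: "g \<in> poly_space n" for s t g
  proof -
    obtain u w where "u \<in> poly_space n1" "w \<in> poly_space n2" "g = w * p - u * q"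
      using poly_space_eq_combinations[OF p q cop(2,1)] g n by metis
    then show ?thesis
      using local_minimax_second_order[OF X X_ne lm irr p q, of s u t w] st
      by (simp add: critical_directions_def kappa_eq_tau \<tau>_def)
  qed
  \<comment> \<open>For the zero direction \<open>rho\<close> vanishes, so the second-order
    condition becomes the first-order one behind claims (1) and (2).\<close>
  have crit0: "(0, 0) \<in> critical_directions n1 n2 X f \<xi> p q"
    by (simp add: critical_directions_def poly_space_def kappa_def)
  have rho0: "rho f \<xi> 0 0 x = 0" for x
    by (simp add: rho_def)

  have weights: "\<exists>\<omega>\<in>W. 0 \<le> (\<Sum>i<d. \<omega> i * rho f \<xi> s t (z i))"
    if st: "(s, t) \<in> critical_directions n1 n2 X f \<xi> p q" for s t
    unfolding W_def dimA
  proof (rule annihilating_weights_alternative)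
    fix c :: "nat \<times> bool \<Rightarrow> real"
    \<comment> \<open>The real multipliers are paired into complex coefficients. The real part of
      such a product is \<open>Re * Re - Im * Im\<close>, which accounts for the negative sign of
      the imaginary block.\<close>
    define g where "g = (\<Sum>k\<le>n. Polynomial.smult (Complex (c (k, False)) (c (k, True))) (\<pi> k))"
    have "g \<in> poly_space n"
      unfolding g_def using poly_space_basis_memb[OF basis] by (intro poly_space_sum_smult) auto
    then obtain x where "x \<in> extreme_points X f \<xi>" and x: "0 \<le> rho f \<xi> s t x + Re (\<tau> x * poly g x)"
      using dual[OF st] by blast
    then obtain i where i: "i < d" "x = z i"
      using z by (auto simp: bij_betw_def)
    have "Re (\<tau> x * poly g x) =
        (\<Sum>k<Suc n. c (k, False) * Re (A $$ (i, k)) - c (k, True) * Im (A $$ (i, k)))"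
      unfolding g_def lessThan_Suc_atMost
      by (auto simp: poly_sum sum_distrib_left i A_index algebra_simps intro!: sum.cong)
    also have "\<dots> = (\<Sum>(k, b)\<in>{..<Suc n} \<times> UNIV. c (k, b) * Re_neg_Im_col A (k, b) i)"
      by (subst sum.cartesian_product[symmetric]) (simp add: UNIV_bool Re_neg_Im_col_def algebra_simps)
    also have "\<dots> = (\<Sum>k\<in>{..<Suc n} \<times> UNIV. c k * Re_neg_Im_col A k i)"
      by (simp add: case_prod_unfold)
    finally show "\<exists>i\<in>{..<d}. 0 \<le> rho f \<xi> s t (z i) + (\<Sum>k\<in>{..<Suc n} \<times> UNIV. c k * Re_neg_Im_col A k i)"
      using x i by auto
  qed auto

  \<comment> \<open>Annihilation of the basis extends to all of \<open>poly_space n\<close> by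
    complex linearity.\<close>
  have ann: "(\<Sum>i<d. of_real (\<omega> i) * (\<tau> (z i) * poly g (z i))) = 0" if "\<omega> \<in> W" "g \<in> poly_space n" for \<omega> g
  proof -
    obtain c where c: "g = (\<Sum>k\<le>n. Polynomial.smult (c k) (\<pi> k))"
      using poly_space_basis_combination[OF basis \<open>g \<in> poly_space n\<close>] .
    have "(\<Sum>i<d. of_real (\<omega> i) * (\<tau> (z i) * poly g (z i))) =
        (\<Sum>i<d. \<Sum>k\<le>n. c k * (of_real (\<omega> i) * A $$ (i, k)))"
      by (auto simp: c poly_sum sum_distrib_left A_index algebra_simps intro!: sum.cong)
    also have "\<dots> = (\<Sum>k\<le>n. c k * (\<Sum>i<d. of_real (\<omega> i) * A $$ (i, k)))"
      by (subst sum.swap) (simp add: sum_distrib_left)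
    also have "\<dots> = 0"
      using \<open>\<omega> \<in> W\<close> by (simp add: W_iff)
    finally show ?thesis .
  qed

  \<comment> \<open>The Kolmogorov-type criterion (1)\<close>
  have "(MAX x\<in>extreme_points X f \<xi>. Re (cnj ((f x - rat_eval \<xi> x) * poly q x) * (poly g x / poly q x))) \<ge> 0"
    if g: "g \<in> poly_space n" for g
  proof -
    obtain x where x: "x \<in> extreme_points X f \<xi>" and "0 \<le> Re (\<tau> x * poly g x)"
      using dual[OF crit0 g] rho0 by auto
    then have "0 \<le> Re (cnj ((f x - rat_eval \<xi> x) * poly q x) * (poly g x / poly q x))"
      unfolding \<tau>_def Re_tau_mult by linarith
    then show ?thesis
      using E_fin x by (subst Max_ge_iff) blast+
  qed

  \<comment> \<open>Few extreme points with positive annihilating weights, claim (2)\<close>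
  moreover have "\<exists>(r::nat) (y :: nat \<Rightarrow> complex) (\<omega> :: nat \<Rightarrow> real).
        n + 2 \<le> r \<and> r \<le> 2 * n + 3 \<and>
        inj_on y {..<r} \<and> y ` {..<r} \<subseteq> extreme_points X f \<xi> \<and>
        (\<forall>j<r. \<omega> j > 0) \<and> (\<Sum>j<r. \<omega> j) = 1 \<and>
        (\<forall>g\<in>poly_space n.
           (\<Sum>j<r. complex_of_real (\<omega> j) * cnj ((f (y j) - rat_eval \<xi> (y j)) * poly q (y j))
                     * poly g (y j) / poly q (y j)) = 0)"
  proof -
    have "W \<noteq> {}"
      using weights[OF crit0] by blast
    \<comment> \<open>The \<open>n + 1\<close> complex equations are \<open>2 * n + 2\<close> real
      ones; with the normalisation this gives the bound \<open>2 * n + 3\<close>.\<close>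
    then obtain \<omega> where w: "\<omega> \<in> W"
      and card_le: "card {i\<in>{..<d}. 0 < \<omega> i} \<le> card ({..<Suc n} \<times> (UNIV :: bool set)) + 1"
      unfolding W_def dimA
      using annihilating_weights_small_support[of "{..<d}" "{..<Suc n} \<times> UNIV" "Re_neg_Im_col A"] by auto
    define S where "S = {i\<in>{..<d}. 0 < \<omega> i}"
    have S: "finite S" "S \<subseteq> {..<d}"
      by (auto simp: S_def)
    have wS: "0 < \<omega> i" if "i \<in> S" for i
      using that by (simp add: S_def)
    have w0: "\<omega> i = 0" if "i \<in> {..<d} - S" for i
      using w that by (force simp: W_iff S_def)
    have sum1: "(\<Sum>i\<in>S. \<omega> i) = 1"
    proof -
      have "(\<Sum>i\<in>S. \<omega> i) = (\<Sum>i<d. \<omega> i)"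
        using S w0 by (intro sum.mono_neutral_left) auto
      then show ?thesis
        using w by (simp add: W_iff)
    qed
    have annS: "(\<Sum>i\<in>S. of_real (\<omega> i) * \<tau> (z i) * poly g (z i)) = 0" if "g \<in> poly_space n" for g
    proof -
      have "(\<Sum>i\<in>S. of_real (\<omega> i) * \<tau> (z i) * poly g (z i)) = (\<Sum>i<d. of_real (\<omega> i) * \<tau> (z i) * poly g (z i))"
        using S w0 by (intro sum.mono_neutral_left) auto
      then show ?thesis
        using ann[OF w that] by (simp add: mult.assoc)
    qed
    have "card S \<le> 2 * n + 3"
      using card_le by (simp add: S_def card_cartesian_product)
    have inj: "inj_on z S"
      using z S by (auto simp: bij_betw_def intro: inj_on_subset)
    \<comment> \<open>A zero of \<open>\<tau>\<close> at an extreme point would make the maximal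
      error 0, and \<open>\<xi>\<close> would agree with \<open>f\<close> on \<open>X\<close>. The
      lower bound on the support needs this nonzero coefficient.\<close>
    have \<tau>nz: "\<tau> (z i) \<noteq> 0" if "i < d" for i
    proof
      assume "\<tau> (z i) = 0"
      moreover have "poly q (z i) \<noteq> 0"
        using qnz zE[OF that] E_sub by auto
      ultimately have "err f \<xi> (z i) = 0"
        by (simp add: \<tau>_def tau_def)
      then have "sup_norm X (err f \<xi>) = 0"
        using zE[OF that] by (simp add: extreme_points_def)
      moreover have "cmod (err f \<xi> x) \<le> sup_norm X (err f \<xi>)" if "x \<in> X" for x
        using X that by (simp add: sup_norm_def)
      ultimately have "err f \<xi> x = 0" if "x \<in> X" for x
        using that by (metis norm_le_zero_iff)
      then have "agrees_on X f \<xi>"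
        using qnz irreducible_repr_rat_pole[OF irr] by (auto simp: agrees_on_def err_def)
      then show False
        using assms(3,4) by blast
    qed
    obtain i where "i \<in> S"
      using sum1 by fastforce
    then have "n + 2 \<le> card S"
      using annihilator_poly_space_card[of S z i "\<lambda>i. of_real (\<omega> i) * \<tau> (z i)" n] S inj wS[of i] \<tau>nz[of i] annS
      by auto
    obtain e where e: "bij_betw e {..<card S} S"
      using ex_bij_betw_nat_finite[OF S(1)] by (auto simp: lessThan_atLeast0)
    have eS: "e j \<in> S" if "j < card S" for j
      using e that by (auto simp: bij_betw_def)
    have reindex: "(\<Sum>j<card S. F (e j)) = (\<Sum>i\<in>S. F i)" for F :: "nat \<Rightarrow> 'b::comm_monoid_add"
      by (rule sum.reindex_bij_betw[OF e])
    have "(\<Sum>j<card S. complex_of_real (\<omega> (e j)) * cnj ((f (z (e j)) - rat_eval \<xi> (z (e j))) * poly q (z (e j)))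
                     * poly g (z (e j)) / poly q (z (e j))) = 0" (is "?l = 0") if "g \<in> poly_space n" for g
    proof -
      \<comment> \<open>The factor 2 is the one in \<open>tau\<close>.\<close>
      have "2 * ?l = (\<Sum>i\<in>S. of_real (\<omega> i) * \<tau> (z i) * poly g (z i))"
        unfolding sum_distrib_left reindex[symmetric]
        by (intro sum.cong refl) (simp add: \<tau>_def tau_def err_def)
      then show ?thesis
        using annS[OF that] by simp
    qed
    moreover have "inj_on (z \<circ> e) {..<card S}"
      using e inj by (auto simp: bij_betw_def intro: comp_inj_on)
    moreover have "(z \<circ> e) ` {..<card S} \<subseteq> extreme_points X f \<xi>"
      using eS S(2) zE by fastforce
    moreover have "(\<Sum>j<card S. \<omega> (e j)) = 1"
      by (simp add: reindex sum1)
    ultimately show ?thesis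
      using \<open>n + 2 \<le> card S\<close> \<open>card S \<le> 2 * n + 3\<close> wS eS
      by (intro exI[of _ "card S"] exI[of _ "z \<circ> e"] exI[of _ "\<omega> \<circ> e"]) auto
  qed

  \<comment> \<open>Attainment and sign of the maximum in (3)\<close>
  moreover have "\<exists>M\<in>objective_values (Re_neg_Im_mat A) (rho_vec f \<xi> s t d z).
          (\<forall>v\<in>objective_values (Re_neg_Im_mat A) (rho_vec f \<xi> s t d z). v \<le> M) \<and> M \<ge> 0"
    if st: "(s, t) \<in> critical_directions n1 n2 X f \<xi> p q" for s t
  proof -
    define F where "F \<omega> = (\<Sum>i<d. \<omega> i * rho f \<xi> s t (z i))" for \<omega>
    have obj: "objective_values (Re_neg_Im_mat A) (rho_vec f \<xi> s t d z) = F ` W"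
      by (simp add: rho_vec_def objective_values_Re_neg_Im_mat dimA F_def W_def)
    obtain \<omega>0 where w0: "\<omega>0 \<in> W" "0 \<le> F \<omega>0"
      using weights[OF st] by (auto simp: F_def)
    \<comment> \<open>The maximum is attained by compactness, and it dominates the nonnegative value
      at the dual weights \<open>\<omega>0\<close>.\<close>
    have "compact W"
      unfolding W_def by (intro compact_annihilating_weights) simp
    moreover have "continuous_on W F"
      unfolding F_def by (rule continuous_on_weighted_sum)
    ultimately obtain \<omega> where "\<omega> \<in> W" "\<And>\<omega>'. \<omega>' \<in> W \<Longrightarrow> F \<omega>' \<le> F \<omega>"
      using continuous_attains_sup[of W F] w0 by blast
    then show ?thesis
      unfolding obj using w0 by (intro bexI[of _ "F \<omega>"]) (auto intro: order_trans)
  qed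
  ultimately show ?thesis
    by (auto simp: A_def)
qed

end
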